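(* Let $\mathcal{H}, \mathcal{K}_1, \mathcal{K}_2$ be closed subspaces of $L^2$ and let $\psi, \phi \in L^{\infty}$. If either $\psi \mathcal{H}^{\perp} \subseteq \mathcal{K}_2^{\perp}$ or $\phi \mathcal{K}_1 \subseteq \mathcal{H}$, then $$T_{\psi\phi}^{\mathcal{K}_1, \mathcal{K}_2} = T_{\psi}^{\mathcal{H}, \mathcal{K}_2}\, T_{\phi}^{\mathcal{K}_1, \mathcal{H}}.$$
   Context: $L^2 = L^2(\mathbb{T}, m)$, with $m$ normalized Lebesgue measure on the unit circle $\mathbb{T}$, and $L^\infty = L^\infty(\mathbb{T},m)$ (complex-valued functions). For a closed subspace $\mathcal{H}$ of $L^2$, $P_{\mathcal{H}}$ is the orthogonal projection of $L^2$ onto $\mathcal{H}$ and $\mathcal{H}^\perp = L^2 \ominus \mathcal{H}$. For $g \in L^\infty$ and a subspace $\mathcal{M}$ of $L^2$, $g\mathcal{M} = \{gf : f \in \mathcal{M}\}$. For closed subspaces $\mathcal{M}, \mathcal{N}$ of $L^2$ and $\phi \in L^\infty$, the generalized Toeplitz operator is $T_\phi^{\mathcal{M},\mathcal{N}} : \mathcal{M} \to \mathcal{N}$, $T_\phi^{\mathcal{M},\mathcal{N}} f = P_{\mathcal{N}}(\phi f)$. *)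

theory Defs
  imports "HOL-Analysis.Analysis" "HOL-Library.FuncSet"
begin

text \<open>
  Normalized Lebesgue measure on the unit circle, as the image of the normalized Lebesgue measure
  on $[0, 2\pi]$ under $t \mapsto e^{it}$. Its space is the circle, so measurability and almost
  everywhere equality ignore the values of a function off the circle.
\<close>

definition circle_measure :: "complex measure" where
  "circle_measure =
     distr (uniform_measure lborel {0..2 * pi}) (restrict_space borel (sphere 0 1)) cis"

definition square_integrable :: "(complex \<Rightarrow> complex) \<Rightarrow> bool" where
  "square_integrable f \<longleftrightarrow>
     f \<in> borel_measurable circle_measure \<and> integrable circle_measure (\<lambda>z. (norm (f z))\<^sup>2)"

definition ess_bounded :: "(complex \<Rightarrow> complex) \<Rightarrow> bool" where
  "ess_bounded f \<longleftrightarrow>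
     f \<in> borel_measurable circle_measure \<and> (\<exists>C. AE z in circle_measure. norm (f z) \<le> C)"

lemma borel_measurable_cnj [measurable]: "cnj \<in> borel_measurable borel"
  by (intro borel_measurable_continuous_onI continuous_intros)

lemma square_integrable_0: "square_integrable (\<lambda>z. 0)"
  by (simp add: square_integrable_def)

lemma square_integrable_add:
  assumes "square_integrable f" "square_integrable g"
  shows "square_integrable (\<lambda>z. f z + g z)"
proof -
  have [measurable]: "f \<in> borel_measurable circle_measure" "g \<in> borel_measurable circle_measure"
    using assms by (auto simp: square_integrable_def)
  have "integrable circle_measure (\<lambda>z. 2 * (norm (f z))\<^sup>2 + 2 * (norm (g z))\<^sup>2)"
    using assms by (auto simp: square_integrable_def)
  then have "integrable circle_measure (\<lambda>z. (norm (f z + g z))\<^sup>2)"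
  proof (rule Bochner_Integration.integrable_bound)
    show "AE z in circle_measure. norm ((norm (f z + g z))\<^sup>2)
            \<le> norm (2 * (norm (f z))\<^sup>2 + 2 * (norm (g z))\<^sup>2)"
    proof (rule AE_I2)
      fix z
      have "(norm (f z + g z))\<^sup>2 \<le> (norm (f z) + norm (g z))\<^sup>2"
        by (intro power_mono norm_triangle_ineq) auto
      also have "\<dots> \<le> 2 * (norm (f z))\<^sup>2 + 2 * (norm (g z))\<^sup>2"
        using sum_squares_bound[of "norm (f z)" "norm (g z)"] by (simp add: power2_sum)
      finally show "norm ((norm (f z + g z))\<^sup>2) \<le> norm (2 * (norm (f z))\<^sup>2 + 2 * (norm (g z))\<^sup>2)"
        by simp
    qed
  qed measurable
  then show ?thesis
    by (simp add: square_integrable_def)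
qed

lemma square_integrable_mult:
  assumes "ess_bounded g" "square_integrable f"
  shows "square_integrable (\<lambda>z. g z * f z)"
proof -
  have [measurable]: "f \<in> borel_measurable circle_measure" "g \<in> borel_measurable circle_measure"
    using assms by (auto simp: square_integrable_def ess_bounded_def)
  obtain C where C: "AE z in circle_measure. norm (g z) \<le> C"
    using assms by (auto simp: ess_bounded_def)
  have "integrable circle_measure (\<lambda>z. C\<^sup>2 * (norm (f z))\<^sup>2)"
    using assms by (auto simp: square_integrable_def)
  then have "integrable circle_measure (\<lambda>z. (norm (g z * f z))\<^sup>2)"
  proof (rule Bochner_Integration.integrable_bound)
    show "AE z in circle_measure. norm ((norm (g z * f z))\<^sup>2) \<le> norm (C\<^sup>2 * (norm (f z))\<^sup>2)"
      using C
    proof eventually_elim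
      case (elim z)
      then have "(norm (g z))\<^sup>2 \<le> C\<^sup>2"
        by (intro power_mono) auto
      then show ?case
        by (auto simp: norm_mult power_mult_distrib intro: mult_right_mono)
    qed
  qed measurable
  then show ?thesis
    by (simp add: square_integrable_def)
qed

lemma ess_bounded_const: "ess_bounded (\<lambda>z. c)"
  by (auto simp: ess_bounded_def)

lemma ess_bounded_mult:
  assumes "ess_bounded f" "ess_bounded g"
  shows "ess_bounded (\<lambda>z. f z * g z)"
proof -
  have [measurable]: "f \<in> borel_measurable circle_measure" "g \<in> borel_measurable circle_measure"
    using assms by (auto simp: ess_bounded_def)
  obtain C D where "AE z in circle_measure. norm (f z) \<le> C" "AE z in circle_measure. norm (g z) \<le> D"
    using assms by (auto simp: ess_bounded_def)
  then have "AE z in circle_measure. norm (f z * g z) \<le> C * D"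
  proof eventually_elim
    case (elim z)
    have "0 \<le> C" using elim(1) norm_ge_zero[of "f z"] by linarith
    then show ?case
      using elim by (auto simp: norm_mult intro!: mult_mono)
  qed
  then show ?thesis
    by (auto simp: ess_bounded_def)
qed

lemma square_integrable_scale:
  "square_integrable f \<Longrightarrow> square_integrable (\<lambda>z. c * f z)"
  by (rule square_integrable_mult[OF ess_bounded_const])

lemma square_integrable_scale':
  "square_integrable f \<Longrightarrow> square_integrable (\<lambda>z. f z * c)"
  using square_integrable_scale[of f c] by (simp add: mult.commute)

lemma square_integrable_uminus:
  "square_integrable f \<Longrightarrow> square_integrable (\<lambda>z. - f z)"
  using square_integrable_scale[of f "-1"] by simp

lemma square_integrable_diff:
  "square_integrable f \<Longrightarrow> square_integrable g \<Longrightarrow> square_integrable (\<lambda>z. f z - g z)"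
  using square_integrable_add[of f "\<lambda>z. - g z"] square_integrable_uminus[of g] by simp

lemma integrable_inner_product:
  assumes "square_integrable f" "square_integrable g"
  shows "integrable circle_measure (\<lambda>z. f z * cnj (g z))"
proof -
  have [measurable]: "f \<in> borel_measurable circle_measure" "g \<in> borel_measurable circle_measure"
    using assms by (auto simp: square_integrable_def)
  have "integrable circle_measure (\<lambda>z. (norm (f z))\<^sup>2 + (norm (g z))\<^sup>2)"
    using assms by (auto simp: square_integrable_def)
  then show ?thesis
  proof (rule Bochner_Integration.integrable_bound)
    show "AE z in circle_measure. norm (f z * cnj (g z)) \<le> norm ((norm (f z))\<^sup>2 + (norm (g z))\<^sup>2)"
    proof (rule AE_I2)
      fix z
      have "norm (f z) * norm (g z) \<le> (norm (f z))\<^sup>2 + (norm (g z))\<^sup>2"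
        using sum_squares_bound[of "norm (f z)" "norm (g z)"]
          mult_nonneg_nonneg[OF norm_ge_zero[of "f z"] norm_ge_zero[of "g z"]] by linarith
      then show "norm (f z * cnj (g z)) \<le> norm ((norm (f z))\<^sup>2 + (norm (g z))\<^sup>2)"
        by (simp add: norm_mult)
    qed
  qed measurable
qed

quotient_type L2 = "complex \<Rightarrow> complex" / partial:
  "\<lambda>f g. square_integrable f \<and> square_integrable g \<and> (AE z in circle_measure. f z = g z)"
  by (rule part_equivpI)
     (auto intro!: exI[of _ "\<lambda>z. 0"] square_integrable_0 sympI transpI elim: AE_mp)

quotient_type Linf = "complex \<Rightarrow> complex" / partial:
  "\<lambda>f g. ess_bounded f \<and> ess_bounded g \<and> (AE z in circle_measure. f z = g z)"
  by (rule part_equivpI)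
     (auto intro!: exI[of _ "\<lambda>z. 0"] ess_bounded_const sympI transpI elim: AE_mp)

instantiation Linf :: times
begin

lift_definition times_Linf :: "Linf \<Rightarrow> Linf \<Rightarrow> Linf" is "\<lambda>f g z. f z * g z"
  by (auto intro: ess_bounded_mult)

instance ..

end

lift_definition mult_L2 :: "Linf \<Rightarrow> L2 \<Rightarrow> L2" (infixr \<open>\<cdot>\<close> 70) is "\<lambda>g f z. g z * f z"
  by (auto intro: square_integrable_mult)

lift_definition scaleC_L2 :: "complex \<Rightarrow> L2 \<Rightarrow> L2" is "\<lambda>c f z. c * f z"
  by (auto intro: square_integrable_scale)

lift_definition cinner_L2 :: "L2 \<Rightarrow> L2 \<Rightarrow> complex"
  is "\<lambda>f g. LINT z|circle_measure. f z * cnj (g z)"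
proof -
  fix f f' g g'
  assume "square_integrable f \<and> square_integrable f' \<and> (AE z in circle_measure. f z = f' z)"
    and "square_integrable g \<and> square_integrable g' \<and> (AE z in circle_measure. g z = g' z)"
  then show "(LINT z|circle_measure. f z * cnj (g z)) = (LINT z|circle_measure. f' z * cnj (g' z))"
    by (intro integral_cong_AE borel_measurable_integrable integrable_inner_product)
       (auto elim!: AE_mp)
qed

instantiation L2 :: scaleR
begin

definition scaleR_L2 :: "real \<Rightarrow> L2 \<Rightarrow> L2" where
  "scaleR_L2 r = scaleC_L2 (complex_of_real r)"

instance ..

end

text \<open>
  The library has no complex inner product spaces, so the real inner product is taken to be the
  real part of \<^const>\<open>cinner_L2\<close>. It induces the same norm, hence the usual topology of $L^2$.
  Linearity of subspaces and orthogonality are nevertheless taken over the complex numbers below.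
\<close>

instantiation L2 :: real_inner
begin

lift_definition zero_L2 :: L2 is "\<lambda>z. 0"
  by (simp add: square_integrable_0)

lift_definition plus_L2 :: "L2 \<Rightarrow> L2 \<Rightarrow> L2" is "\<lambda>f g z. f z + g z"
  by (auto intro: square_integrable_add)

lift_definition uminus_L2 :: "L2 \<Rightarrow> L2" is "\<lambda>f z. - f z"
  by (auto intro: square_integrable_uminus)

lift_definition minus_L2 :: "L2 \<Rightarrow> L2 \<Rightarrow> L2" is "\<lambda>f g z. f z - g z"
  by (auto intro: square_integrable_diff)

definition inner_L2 :: "L2 \<Rightarrow> L2 \<Rightarrow> real" where
  "inner_L2 f g = Re (cinner_L2 f g)"

definition norm_L2 :: "L2 \<Rightarrow> real" where
  "norm_L2 f = sqrt (inner f f)"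

definition dist_L2 :: "L2 \<Rightarrow> L2 \<Rightarrow> real" where
  "dist_L2 f g = norm (f - g)"

definition sgn_L2 :: "L2 \<Rightarrow> L2" where
  "sgn_L2 f = f /\<^sub>R norm f"

definition uniformity_L2 :: "(L2 \<times> L2) filter" where
  "uniformity_L2 = (INF e\<in>{0 <..}. principal {(f, g). dist f g < e})"

definition open_L2 :: "L2 set \<Rightarrow> bool" where
  "open_L2 U \<longleftrightarrow> (\<forall>f\<in>U. eventually (\<lambda>(f', g). f' = f \<longrightarrow> g \<in> U) uniformity)"

instance
proof
  fix f g h :: L2 and r s :: real
  show "f + g + h = f + (g + h)"
    by transfer (auto intro!: square_integrable_add simp: algebra_simps)
  show "f + g = g + f"
    by transfer (auto intro!: square_integrable_add simp: algebra_simps)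
  show "0 + f = f"
    by transfer (auto)
  show "- f + f = 0"
    by transfer (auto intro: square_integrable_0)
  show "f - g = f + - g"
    by transfer (auto intro: square_integrable_diff)
  show "r *\<^sub>R (f + g) = r *\<^sub>R f + r *\<^sub>R g"
    unfolding scaleR_L2_def
    by transfer (auto intro!: square_integrable_add square_integrable_scale square_integrable_scale' simp: algebra_simps)
  show "(r + s) *\<^sub>R f = r *\<^sub>R f + s *\<^sub>R f"
    unfolding scaleR_L2_def
    by transfer (auto intro!: square_integrable_add square_integrable_scale square_integrable_scale' simp: algebra_simps)
  show "r *\<^sub>R s *\<^sub>R f = (r * s) *\<^sub>R f"
    unfolding scaleR_L2_def
    by transfer (auto intro!: square_integrable_scale square_integrable_scale' simp: algebra_simps)
  show "1 *\<^sub>R f = f"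
    unfolding scaleR_L2_def by transfer auto
  show "dist f g = norm (f - g)" by (fact dist_L2_def)
  show "sgn f = f /\<^sub>R norm f" by (fact sgn_L2_def)
  show "uniformity = (INF e\<in>{0 <..}. principal {(f :: L2, g). dist f g < e})"
    by (fact uniformity_L2_def)
  show "open U \<longleftrightarrow> (\<forall>f\<in>U. eventually (\<lambda>(f', g). f' = f \<longrightarrow> g \<in> U) uniformity)" for U :: "L2 set"
    by (fact open_L2_def)
  show "norm f = sqrt (inner f f)" by (fact norm_L2_def)
  have cnj: "cinner_L2 f g = cnj (cinner_L2 g f)"
    by transfer (subst Bochner_Integration.integral_cnj [symmetric], simp add: mult.commute)
  show "inner f g = inner g f"
    unfolding inner_L2_def by (subst cnj) simp
  show "inner (f + g) h = inner f h + inner g h"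
    unfolding inner_L2_def
    by transfer (simp add: distrib_right integrable_inner_product)
  show "inner (r *\<^sub>R f) g = r * inner f g"
    unfolding inner_L2_def scaleR_L2_def
    by transfer (simp add: mult.assoc)
  have sq: "(LINT z|circle_measure. u z * cnj (u z)) =
              complex_of_real (LINT z|circle_measure. (norm (u z))\<^sup>2)" for u
    by (simp flip: complex_norm_square integral_complex_of_real)
  show "0 \<le> inner f f"
    unfolding inner_L2_def by transfer (simp add: sq)
  show "inner f f = 0 \<longleftrightarrow> f = 0"
    unfolding inner_L2_def
    by transfer
       (auto simp: sq square_integrable_0 square_integrable_def integral_nonneg_eq_0_iff_AE)
qed

end

interpretation L2: vector_space scaleC_L2
proof
  fix a b :: complex and f g :: L2
  show "scaleC_L2 a (f + g) = scaleC_L2 a f + scaleC_L2 a g"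
    by transfer (auto intro!: square_integrable_add square_integrable_scale square_integrable_scale' simp: algebra_simps)
  show "scaleC_L2 (a + b) f = scaleC_L2 a f + scaleC_L2 b f"
    by transfer (auto intro!: square_integrable_add square_integrable_scale square_integrable_scale' simp: algebra_simps)
  show "scaleC_L2 a (scaleC_L2 b f) = scaleC_L2 (a * b) f"
    by transfer (auto intro!: square_integrable_scale square_integrable_scale' simp: algebra_simps)
  show "scaleC_L2 1 f = f"
    by transfer auto
qed

definition closed_subspace :: "L2 set \<Rightarrow> bool" where
  "closed_subspace M \<longleftrightarrow> L2.subspace M \<and> closed M"

definition orth_complement :: "L2 set \<Rightarrow> L2 set" where
  "orth_complement M = {f. \<forall>g\<in>M. cinner_L2 f g = 0}"

text \<open>
  For a closed subspace \<open>M\<close> such a \<open>g\<close> exists and is unique, by the projection theorem.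
\<close>

definition orth_proj :: "L2 set \<Rightarrow> L2 \<Rightarrow> L2" where
  "orth_proj M f = (THE g. g \<in> M \<and> f - g \<in> orth_complement M)"

text \<open>
  Operators from \<open>M\<close> to \<open>N\<close> are represented by extensional functions on \<open>M\<close> (\<^term>\<open>undefined\<close>
  outside \<open>M\<close>), so that \<open>=\<close> is equality of operators and \<^const>\<open>compose\<close> is their product.
\<close>

definition toeplitz :: "Linf \<Rightarrow> L2 set \<Rightarrow> L2 set \<Rightarrow> L2 \<Rightarrow> L2" where
  "toeplitz \<phi> M N = (\<lambda>f\<in>M. orth_proj N (\<phi> \<cdot> f))"

end

theory Submission imports Defs begin

text \<open>
  Let \<open>f \<in> K1\<close> and \<open>p = orth_proj H (\<phi> \<cdot> f)\<close>. The operator on the right maps \<open>f\<close> to the projection of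
  \<open>\<psi> \<cdot> p\<close> to \<open>K2\<close>, the one on the left maps it to the projection of \<open>\<psi> \<cdot> (\<phi> \<cdot> f)\<close> to \<open>K2\<close>. Projecting
  to \<open>K2\<close> ignores vectors orthogonal to \<open>K2\<close>, so it is enough that the error \<open>\<psi> \<cdot> (\<phi> \<cdot> f - p)\<close> is orthogonal to \<open>K2\<close>.
  As \<open>\<phi> \<cdot> f - p\<close> is orthogonal to \<open>H\<close>, the first alternative of the hypothesis says exactly this. Under
  the second one \<open>\<phi> \<cdot> f\<close> lies in \<open>H\<close>, so \<open>\<phi> \<cdot> f - p\<close> is both in \<open>H\<close> and orthogonal to \<open>H\<close>, and the
  error is \<open>0\<close>.

  The analytic input is the existence of \<open>p\<close>, that is, the projection theorem
  (\<open>orth_proj_works\<close>). A minimizing sequence for the distance to a closed convex set is Cauchy by the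
  parallelogram law (\<open>nearest_point_exists\<close>), so the theorem rests on the completeness of $L^2$
  (\<open>Cauchy_L2_convergent\<close>). On a finite measure space an $L^2$-Cauchy sequence is also
  $L^1$-Cauchy, so a subsequence converges almost everywhere, and Fatou's lemma shows that the
  pointwise limit is a limit in $L^2$.
\<close>

section \<open>Completeness of $L^2$\<close>

lemma abs_L2_cases:
  obtains u where "square_integrable u" "f = abs_L2 u"
  by (induct f rule: L2.abs_induct) auto

lemma abs_L2_diff:
  assumes "square_integrable u" "square_integrable v"
  shows "abs_L2 u - abs_L2 v = abs_L2 (\<lambda>z. u z - v z)"
  using assms by (simp add: minus_L2.abs_eq)

lemma inner_abs_L2:
  assumes "square_integrable u" "square_integrable v"
  shows "inner (abs_L2 u) (abs_L2 v) = Re (LINT z|circle_measure. u z * cnj (v z))"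
  using assms by (simp add: inner_L2_def cinner_L2.abs_eq)

lemma norm_abs_L2_power2:
  assumes "square_integrable u"
  shows "(norm (abs_L2 u))\<^sup>2 = (LINT z|circle_measure. (norm (u z))\<^sup>2)"
proof -
  have "(LINT z|circle_measure. u z * cnj (u z)) =
          complex_of_real (LINT z|circle_measure. (norm (u z))\<^sup>2)"
    by (simp flip: complex_norm_square integral_complex_of_real)
  then show ?thesis
    using assms by (simp add: power2_norm_eq_inner inner_abs_L2)
qed

lemma nn_integral_norm_abs_L2:
  assumes "square_integrable u"
  shows "(\<integral>\<^sup>+z. ennreal ((norm (u z))\<^sup>2) \<partial>circle_measure) = ennreal ((norm (abs_L2 u))\<^sup>2)"
  using assms by (simp add: norm_abs_L2_power2 nn_integral_eq_integral square_integrable_def)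

lemma finite_measure_circle_measure: "finite_measure circle_measure"
proof
  have [measurable]: "cis \<in> uniform_measure lborel {0..2 * pi} \<rightarrow>\<^sub>M restrict_space borel (sphere 0 1)"
    using borel_measurable_continuous_onI[of cis] continuous_on_cis[of UNIV "\<lambda>t. t"]
    by (intro measurable_restrict_space2) (auto cong: measurable_cong_sets)
  have "emeasure circle_measure (space circle_measure) =
          emeasure (uniform_measure lborel {0..2 * pi}) (cis -` sphere 0 1)"
    unfolding circle_measure_def
    by (subst emeasure_distr) (auto simp: space_restrict_space sets_restrict_space)
  also have "cis -` sphere 0 1 = UNIV"
    by auto
  also have "emeasure (uniform_measure lborel {0..2 * pi}) UNIV = 1"
    by (subst emeasure_uniform_measure) (auto simp: ennreal_divide_self)
  finally show "emeasure circle_measure (space circle_measure) \<noteq> \<infinity>"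
    by simp
qed

lemma square_integrable_const: "square_integrable (\<lambda>z. c)"
  using finite_measure.integrable_const[OF finite_measure_circle_measure]
  by (simp add: square_integrable_def)

lemma square_integrable_imp_integrable:
  assumes "square_integrable u"
  shows "integrable circle_measure u"
  using integrable_inner_product[OF assms square_integrable_const[of 1]] by simp

text \<open>The $L^1$ norm of \<open>u\<close> is the inner product of \<open>\<bar>u\<bar>\<close> with \<open>1\<close>, to which Cauchy-Schwarz applies.\<close>

lemma integral_norm_le_norm_L2:
  assumes u: "square_integrable u"
  shows "(LINT z|circle_measure. norm (u z)) \<le> norm (abs_L2 u) * norm (abs_L2 (\<lambda>z. 1))"
proof -
  let ?v = "\<lambda>z. complex_of_real (norm (u z))"
  have v: "square_integrable ?v"
    using u by (auto simp: square_integrable_def)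
  have "(LINT z|circle_measure. norm (u z)) = inner (abs_L2 ?v) (abs_L2 (\<lambda>z. 1))"
    using v square_integrable_const by (simp add: inner_abs_L2)
  also have "\<dots> \<le> norm (abs_L2 ?v) * norm (abs_L2 (\<lambda>z. 1))"
    by (rule norm_cauchy_schwarz)
  also have "norm (abs_L2 ?v) = norm (abs_L2 u)"
    using norm_abs_L2_power2[OF u] norm_abs_L2_power2[OF v]
    by (auto intro: power2_eq_imp_eq)
  finally show ?thesis .
qed

text \<open>The $L^1$ norm is dominated by the $L^2$ norm, so the subsequence theorem for $L^1$ applies.\<close>

lemma Cauchy_L2_AE_Cauchy_subseq:
  assumes F: "\<And>n. square_integrable (F n)" and "Cauchy (\<lambda>n. abs_L2 (F n))"
  obtains r where "strict_mono r" "AE z in circle_measure. Cauchy (\<lambda>n. F (r n) z)"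
proof (rule cauchy_L1_AE_cauchy_subseq[of circle_measure F])
  show "integrable circle_measure (F n)" for n
    by (intro square_integrable_imp_integrable F)
  fix e :: real assume "e > 0"
  \<comment> \<open>Adding \<open>1\<close> allows a division by \<open>?c\<close> without computing the norm of the constant function.\<close>
  let ?c = "norm (abs_L2 (\<lambda>z. 1)) + 1"
  have c: "?c > 0"
    by (simp add: add_nonneg_pos)
  then obtain N where N: "\<And>m n. m \<ge> N \<Longrightarrow> n \<ge> N \<Longrightarrow> norm (abs_L2 (F m) - abs_L2 (F n)) < e / ?c"
    using CauchyD[OF assms(2), of "e / ?c"] \<open>e > 0\<close> by auto
  have "(LINT z|circle_measure. norm (F m z - F n z)) < e" if "m \<ge> N" "n \<ge> N" for m n
  proof -
    have "(LINT z|circle_measure. norm (F m z - F n z))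
            \<le> norm (abs_L2 (F m) - abs_L2 (F n)) * norm (abs_L2 (\<lambda>z. 1))"
      using integral_norm_le_norm_L2[OF square_integrable_diff[OF F F]] F by (simp add: abs_L2_diff)
    also have "\<dots> \<le> norm (abs_L2 (F m) - abs_L2 (F n)) * ?c"
      by (intro mult_left_mono) auto
    also have "\<dots> < e"
      using N[OF that] c by (simp add: pos_less_divide_eq)
    finally show ?thesis .
  qed
  then show "\<exists>N. \<forall>i\<ge>N. \<forall>j\<ge>N. (LINT z|circle_measure. norm (F i z - F j z)) < e"
    by blast
qed (rule that)

text \<open>
  Fatou's lemma for the squared norms. That \<open>g\<close> is square integrable is part of the conclusion, so
  the lemma also produces elements of $L^2$ from pointwise limits.
\<close>

lemma norm_L2_AE_limit_le:
  assumes F: "\<And>k. square_integrable (F k)" and g [measurable]: "g \<in> borel_measurable circle_measure"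
    and lim: "AE z in circle_measure. (\<lambda>k. F k z) \<longlonglongrightarrow> g z"
    and bound: "eventually (\<lambda>k. norm (abs_L2 (F k)) \<le> e) sequentially" and "0 \<le> e"
  shows "square_integrable g" "norm (abs_L2 g) \<le> e"
proof -
  have [measurable]: "F k \<in> borel_measurable circle_measure" for k
    using F by (auto simp: square_integrable_def)
  have "(\<integral>\<^sup>+z. ennreal ((norm (g z))\<^sup>2) \<partial>circle_measure)
          = (\<integral>\<^sup>+z. liminf (\<lambda>k. ennreal ((norm (F k z))\<^sup>2)) \<partial>circle_measure)"
    using lim
  proof (intro nn_integral_cong_AE, eventually_elim)
    case (elim z)
    then have "(\<lambda>k. ennreal ((norm (F k z))\<^sup>2)) \<longlonglongrightarrow> ennreal ((norm (g z))\<^sup>2)"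
      by (intro tendsto_ennrealI tendsto_power tendsto_norm)
    from lim_imp_Liminf[OF _ this] show ?case
      by simp
  qed
  also have "\<dots> \<le> liminf (\<lambda>k. \<integral>\<^sup>+z. ennreal ((norm (F k z))\<^sup>2) \<partial>circle_measure)"
    by (rule nn_integral_liminf) measurable
  also have "\<dots> = liminf (\<lambda>k. ennreal ((norm (abs_L2 (F k)))\<^sup>2))"
    using F by (simp add: nn_integral_norm_abs_L2)
  also have "\<dots> \<le> limsup (\<lambda>k. ennreal ((norm (abs_L2 (F k)))\<^sup>2))"
    by (rule Liminf_le_Limsup) simp
  also have "\<dots> \<le> ennreal (e\<^sup>2)"
    by (rule Limsup_bounded) (use bound in eventually_elim, auto intro!: ennreal_leI power_mono)
  finally have le: "(\<integral>\<^sup>+z. ennreal ((norm (g z))\<^sup>2) \<partial>circle_measure) \<le> ennreal (e\<^sup>2)" .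
  then have "(\<integral>\<^sup>+z. ennreal ((norm (g z))\<^sup>2) \<partial>circle_measure) < \<infinity>"
    by (rule order.strict_trans1) simp
  then show sq: "square_integrable g"
    by (simp add: square_integrable_def integrable_iff_bounded)
  show "norm (abs_L2 g) \<le> e"
  proof (rule power2_le_imp_le)
    show "(norm (abs_L2 g))\<^sup>2 \<le> e\<^sup>2"
      using le by (simp add: nn_integral_norm_abs_L2[OF sq])
  qed (fact \<open>0 \<le> e\<close>)
qed

text \<open>
  The limit \<open>g\<close> is the pointwise limit of the subsequence. For fixed large \<open>n\<close> the differences
  \<open>F n - F (r k)\<close> are small in $L^2$ for all large \<open>k\<close> and converge to \<open>F n - g\<close>, so Fatou bounds
  \<open>F n - g\<close>.
\<close>

lemma Cauchy_L2_convergent: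
  fixes X :: "nat \<Rightarrow> L2"
  assumes "Cauchy X"
  shows "convergent X"
proof -
  have "\<exists>F. \<forall>n. square_integrable (F n) \<and> X n = abs_L2 (F n)"
    by (intro choice allI) (metis abs_L2_cases)
  then obtain F where F: "\<And>n. square_integrable (F n)" and X: "X = (\<lambda>n. abs_L2 (F n))"
    by auto
  obtain r where r: "strict_mono r" and AE_Cauchy: "AE z in circle_measure. Cauchy (\<lambda>k. F (r k) z)"
    using Cauchy_L2_AE_Cauchy_subseq[of F] F assms unfolding X by blast
  define g where "g z = lim (\<lambda>k. F (r k) z)" for z
  have [measurable]: "F n \<in> borel_measurable circle_measure" for n
    using F by (auto simp: square_integrable_def)
  have [measurable]: "g \<in> borel_measurable circle_measure"
    unfolding g_def by measurable
  have lim: "AE z in circle_measure. (\<lambda>k. F (r k) z) \<longlonglongrightarrow> g z"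
    using AE_Cauchy by eventually_elim (simp add: g_def Cauchy_convergent_iff convergent_LIMSEQ_iff)
  have close: "\<exists>N. \<forall>n\<ge>N. square_integrable (\<lambda>z. F n z - g z) \<and> norm (abs_L2 (\<lambda>z. F n z - g z)) \<le> e"
    if "e > 0" for e
  proof -
    obtain N where N: "\<And>m n. m \<ge> N \<Longrightarrow> n \<ge> N \<Longrightarrow> norm (X m - X n) < e"
      using CauchyD[OF assms \<open>e > 0\<close>] by blast
    have "square_integrable (\<lambda>z. F n z - g z) \<and> norm (abs_L2 (\<lambda>z. F n z - g z)) \<le> e"
      if n: "n \<ge> N" for n
    proof -
      have "eventually (\<lambda>k. r k \<ge> N) sequentially"
        using filterlim_subseq[OF r] by (simp add: filterlim_at_top)
      then have bound: "eventually (\<lambda>k. norm (abs_L2 (\<lambda>z. F n z - F (r k) z)) \<le> e) sequentially"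
        by eventually_elim (use N[OF n] F in \<open>auto simp: X abs_L2_diff intro: less_imp_le\<close>)
      have "AE z in circle_measure. (\<lambda>k. F n z - F (r k) z) \<longlonglongrightarrow> F n z - g z"
        using lim by eventually_elim (intro tendsto_intros)
      then show ?thesis
        using norm_L2_AE_limit_le[OF square_integrable_diff[OF F F] _ _ bound] \<open>e > 0\<close> by simp
    qed
    then show ?thesis
      by blast
  qed
  obtain n where "square_integrable (\<lambda>z. F n z - g z)"
    using close[of 1] by auto
  then have g: "square_integrable g"
    using square_integrable_diff[OF F[of n], of "\<lambda>z. F n z - g z"] by simp
  have "X \<longlonglongrightarrow> abs_L2 g"
  proof (rule LIMSEQ_I)
    fix e :: real assume "e > 0"
    then obtain N where N: "\<And>n. n \<ge> N \<Longrightarrow> norm (abs_L2 (\<lambda>z. F n z - g z)) \<le> e / 2"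
      using close[of "e / 2"] by auto
    have "norm (X n - abs_L2 g) < e" if "n \<ge> N" for n
      using N[OF that] \<open>e > 0\<close> by (simp add: X abs_L2_diff F g)
    then show "\<exists>N. \<forall>n\<ge>N. norm (X n - abs_L2 g) < e"
      by blast
  qed
  then show ?thesis
    by (rule convergentI)
qed

instance L2 :: complete_space
proof
  fix X :: "nat \<Rightarrow> L2"
  show "convergent X" if "Cauchy X"
    using that by (rule Cauchy_L2_convergent)
qed

section \<open>The projection theorem\<close>

text \<open>
  If \<open>x\<close> and \<open>y\<close> nearly realize the distance from \<open>a\<close> to \<open>S\<close>, then their midpoint, being in
  \<open>S\<close>, is not much closer to \<open>a\<close>, and the parallelogram law with sides \<open>a - x\<close> and \<open>a - y\<close> leaves no
  room for \<open>x - y\<close>. So a minimizing sequence is Cauchy.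
\<close>

lemma nearest_point_exists:
  fixes S :: "'a::{real_inner, complete_space} set"
  assumes "convex S" "closed S" "S \<noteq> {}"
  obtains x where "x \<in> S" "\<And>z. z \<in> S \<Longrightarrow> dist a x \<le> dist a z"
proof -
  let ?d = "infdist a S"
  have "\<exists>x\<in>S. (dist a x)\<^sup>2 < ?d\<^sup>2 + inverse (Suc n)" for n
  proof -
    have "?d < sqrt (?d\<^sup>2 + inverse (Suc n))"
      by (rule real_less_rsqrt) simp
    then obtain x where "x \<in> S" "dist a x < sqrt (?d\<^sup>2 + inverse (Suc n))"
      using \<open>S \<noteq> {}\<close> cInf_lessD[of "dist a ` S"] by (auto simp: infdist_notempty)
    then have "(dist a x)\<^sup>2 < (sqrt (?d\<^sup>2 + inverse (Suc n)))\<^sup>2"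
      by (intro power_strict_mono) auto
    with \<open>x \<in> S\<close> show ?thesis
      by (intro bexI[of _ x]) simp_all
  qed
  then obtain x where x: "\<And>n. x n \<in> S" "\<And>n. (dist a (x n))\<^sup>2 < ?d\<^sup>2 + inverse (Suc n)"
    by metis
  have near: "(dist (x m) (x n))\<^sup>2 \<le> 2 * inverse (Suc m) + 2 * inverse (Suc n)" for m n
  proof -
    let ?mid = "(1/2) *\<^sub>R x m + (1/2) *\<^sub>R x n"
    have "?mid \<in> S"
      using x(1) by (intro convexD[OF \<open>convex S\<close>]) auto
    then have "?d\<^sup>2 \<le> (dist a ?mid)\<^sup>2"
      by (intro power_mono infdist_le infdist_nonneg)
    moreover have "(dist (x m) (x n))\<^sup>2 + 4 * (dist a ?mid)\<^sup>2
                     = 2 * (dist a (x m))\<^sup>2 + 2 * (dist a (x n))\<^sup>2"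
      by (simp add: dist_norm power2_norm_eq_inner inner_simps inner_commute field_simps)
    ultimately show ?thesis
      using x(2)[of m] x(2)[of n] by linarith
  qed
  have "Cauchy x"
  proof (rule metric_CauchyI)
    fix e :: real assume "e > 0"
    \<comment> \<open>The two terms of \<open>near\<close> are then at most \<open>e\<^sup>2 / 2\<close> each.\<close>
    then obtain N where N: "inverse (real (Suc N)) < e\<^sup>2 / 4"
      using reals_Archimedean[of "e\<^sup>2 / 4"] by auto
    have "dist (x m) (x n) < e" if "m \<ge> N" "n \<ge> N" for m n
    proof (rule power2_less_imp_less)
      have "inverse (real (Suc m)) \<le> inverse (real (Suc N))"
        "inverse (real (Suc n)) \<le> inverse (real (Suc N))"
        using that by (auto intro!: le_imp_inverse_le)
      with N near[of m n] show "(dist (x m) (x n))\<^sup>2 < e\<^sup>2"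
        by linarith
    qed (use \<open>e > 0\<close> in simp)
    then show "\<exists>N. \<forall>m\<ge>N. \<forall>n\<ge>N. dist (x m) (x n) < e"
      by blast
  qed
  then obtain l where l: "x \<longlonglongrightarrow> l"
    using Cauchy_convergent_iff convergent_def by blast
  then have "l \<in> S"
    using \<open>closed S\<close> x(1) closed_sequentially by blast
  moreover have "dist a l \<le> dist a z" if "z \<in> S" for z
  proof -
    have "(dist a l)\<^sup>2 \<le> ?d\<^sup>2 + 0"
    proof (rule LIMSEQ_le)
      show "(\<lambda>n. (dist a (x n))\<^sup>2) \<longlonglongrightarrow> (dist a l)\<^sup>2"
        by (intro tendsto_intros l)
      show "(\<lambda>n. ?d\<^sup>2 + inverse (real (Suc n))) \<longlonglongrightarrow> ?d\<^sup>2 + 0"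
        by (intro tendsto_intros LIMSEQ_inverse_real_of_nat)
    qed (use x(2) less_imp_le in blast)
    then have "dist a l \<le> ?d"
      using power2_le_imp_le[of "dist a l" ?d] by (simp add: infdist_nonneg)
    also have "\<dots> \<le> dist a z"
      using that by (rule infdist_le)
    finally show ?thesis .
  qed
  ultimately show ?thesis
    by (rule that)
qed

lemma cinner_L2_diff_left: "cinner_L2 (f - g) h = cinner_L2 f h - cinner_L2 g h"
  by transfer (simp add: left_diff_distrib integrable_inner_product)

lemma cinner_L2_scaleC_right: "cinner_L2 f (scaleC_L2 c g) = cnj c * cinner_L2 f g"
proof transfer
  fix f g :: "complex \<Rightarrow> complex" and c
  have "(LINT z|circle_measure. f z * cnj (c * g z)) = (LINT z|circle_measure. cnj c * (f z * cnj (g z)))"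
    by (simp add: mult_ac)
  then show "(LINT z|circle_measure. f z * cnj (c * g z)) = cnj c * (LINT z|circle_measure. f z * cnj (g z))"
    by simp
qed

lemma orth_complement_diff:
  "f \<in> orth_complement M \<Longrightarrow> g \<in> orth_complement M \<Longrightarrow> f - g \<in> orth_complement M"
  by (simp add: orth_complement_def cinner_L2_diff_left)

lemma zero_in_orth_complement: "0 \<in> orth_complement M"
  using cinner_L2_diff_left[of 0 0] by (simp add: orth_complement_def)

lemma orth_complement_inter:
  assumes "f \<in> M" "f \<in> orth_complement M"
  shows "f = 0"
proof -
  have "inner f f = 0"
    using assms by (simp add: orth_complement_def inner_L2_def)
  then show ?thesis
    by simp
qed

lemma orthogonal_component_exists:
  assumes "closed_subspace M"
  obtains p where "p \<in> M" "f - p \<in> orth_complement M"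
proof -
  have M: "L2.subspace M" "closed M"
    using assms by (auto simp: closed_subspace_def)
  have convex: "convex M"
    unfolding convex_def scaleR_L2_def using M(1) by (auto intro: L2.subspace_add L2.subspace_scale)
  obtain p where p: "p \<in> M" "\<And>g. g \<in> M \<Longrightarrow> dist f p \<le> dist f g"
    using nearest_point_exists[OF convex \<open>closed M\<close>, of f] L2.subspace_0[OF M(1)] by blast
  \<comment> \<open>The variational inequality at \<open>p\<close>, applied to \<open>h\<close> and to \<open>- h\<close>, gives real orthogonality.\<close>
  have le: "inner (f - p) h \<le> 0" if "h \<in> M" for h
    using any_closest_point_dot[OF convex \<open>closed M\<close> p(1), of "p + h" f] p M(1) that
    by (simp add: L2.subspace_add)
  have Re: "Re (cinner_L2 (f - p) h) = 0" if "h \<in> M" for h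
    using le[OF that] le[OF L2.subspace_neg[OF M(1) that]] by (simp add: inner_L2_def [symmetric])
  \<comment> \<open>Only the real part is known to vanish; testing with \<open>\<i> h\<close> gives the imaginary part.\<close>
  have "cinner_L2 (f - p) h = 0" if "h \<in> M" for h
    using Re[OF that] Re[OF L2.subspace_scale[OF M(1) that, of \<i>]]
    by (simp add: cinner_L2_scaleC_right complex_eq_iff)
  then show ?thesis
    using that p(1) by (simp add: orth_complement_def)
qed

lemma orth_proj_works:
  assumes "closed_subspace M"
  shows "orth_proj M f \<in> M" "f - orth_proj M f \<in> orth_complement M"
proof -
  have "\<exists>!p. p \<in> M \<and> f - p \<in> orth_complement M"
  proof (rule ex_ex1I)
    show "\<exists>p. p \<in> M \<and> f - p \<in> orth_complement M"
      using orthogonal_component_exists[OF assms] by metis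
    fix p q assume p: "p \<in> M \<and> f - p \<in> orth_complement M" and q: "q \<in> M \<and> f - q \<in> orth_complement M"
    have "p - q \<in> M"
      using p q assms by (auto simp: closed_subspace_def intro: L2.subspace_diff)
    moreover have "p - q \<in> orth_complement M"
      using p q orth_complement_diff[of "f - q" M "f - p"] by simp
    ultimately show "p = q"
      using orth_complement_inter[of "p - q" M] by simp
  qed
  from theI'[OF this] show "orth_proj M f \<in> M" "f - orth_proj M f \<in> orth_complement M"
    by (auto simp: orth_proj_def)
qed

text \<open>
  The condition defining \<open>orth_proj M f\<close> depends on \<open>f\<close> only through its inner products with \<open>M\<close>.
\<close>

lemma orth_proj_cong:
  assumes "f - g \<in> orth_complement M"
  shows "orth_proj M f = orth_proj M g"
proof -
  have "f - p \<in> orth_complement M \<longleftrightarrow> g - p \<in> orth_complement M" for p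
    using assms by (simp add: orth_complement_def cinner_L2_diff_left)
  then show ?thesis
    by (simp add: orth_proj_def)
qed

section \<open>Products of generalized Toeplitz operators\<close>

lemma times_Linf_mult_L2: "(\<psi> * \<phi>) \<cdot> f = \<psi> \<cdot> (\<phi> \<cdot> f)"
  by transfer (auto intro!: square_integrable_mult simp: mult.assoc)

lemma mult_L2_diff_right: "\<psi> \<cdot> (f - g) = \<psi> \<cdot> f - \<psi> \<cdot> g"
  by transfer (auto intro!: square_integrable_mult square_integrable_diff simp: right_diff_distrib)

theorem theorem2p6:
  fixes H K1 K2 :: "L2 set" and \<psi> \<phi> :: Linf
  assumes "closed_subspace H" and "closed_subspace K1" and "closed_subspace K2"
    and "(\<cdot>) \<psi> ` orth_complement H \<subseteq> orth_complement K2 \<or> (\<cdot>) \<phi> ` K1 \<subseteq> H"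
  shows "toeplitz (\<psi> * \<phi>) K1 K2 = compose K1 (toeplitz \<psi> H K2) (toeplitz \<phi> K1 H)"
proof
  fix f
  show "toeplitz (\<psi> * \<phi>) K1 K2 f = compose K1 (toeplitz \<psi> H K2) (toeplitz \<phi> K1 H) f"
  proof (cases "f \<in> K1")
    case True
    define p where "p = orth_proj H (\<phi> \<cdot> f)"
    have p: "p \<in> H" "\<phi> \<cdot> f - p \<in> orth_complement H"
      unfolding p_def using orth_proj_works[OF assms(1)] by auto
    have "\<psi> \<cdot> (\<phi> \<cdot> f - p) \<in> orth_complement K2"
      using assms(4)
    proof
      assume "(\<cdot>) \<psi> ` orth_complement H \<subseteq> orth_complement K2"
      with p(2) show ?thesis
        by blast
    next
      assume "(\<cdot>) \<phi> ` K1 \<subseteq> H"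
      with True p(1) have "\<phi> \<cdot> f - p \<in> H"
        using assms(1) by (auto simp: closed_subspace_def intro: L2.subspace_diff)
      with p(2) have "\<phi> \<cdot> f - p = 0"
        by (intro orth_complement_inter)
      moreover have "\<psi> \<cdot> 0 = 0"
        using mult_L2_diff_right[of \<psi> 0 0] by simp
      ultimately show ?thesis
        by (simp add: zero_in_orth_complement)
    qed
    then have "orth_proj K2 (\<psi> \<cdot> (\<phi> \<cdot> f)) = orth_proj K2 (\<psi> \<cdot> p)"
      by (intro orth_proj_cong) (simp add: mult_L2_diff_right)
    with True p(1) show ?thesis
      by (simp add: toeplitz_def compose_def times_Linf_mult_L2 p_def)
  next
    case False
    then show ?thesis
      by (simp add: toeplitz_def compose_def)
  qed
qed

end
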